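(* The space of invariant spinors on $(S^7=\mathrm{Spin}(7)/\mathrm G_2,g)$, where $g=B_0|_{\mathfrak m}$, is $$\Sigma_{\mathrm{inv}}=\mathrm{span}_{\mathbb C}\{-1+y_1\wedge y_2\wedge y_3\},$$ and the spinor $\psi:=-1+y_1\wedge y_2\wedge y_3$ is a Riemannian Killing spinor: $$\nabla^g_X\psi=\frac{\sqrt3}{4\sqrt2}X\cdot\psi.$$
   Context: Let $\rho(\epsilon_1),\dots,\rho(\epsilon_7)$ be the following real skew-symmetric $8\times8$ matrices, where $E_{i,j}$ has $-1$ in position $(i,j)$, $+1$ in $(j,i)$ and zeros elsewhere; they satisfy $\rho(\epsilon_i)\rho(\epsilon_j)+\rho(\epsilon_j)\rho(\epsilon_i)=-2\delta_{ij}$: $\rho(\epsilon_1)=E_{1,8}+E_{2,7}-E_{3,6}-E_{4,5}$, $\rho(\epsilon_2)=-E_{1,7}+E_{2,8}+E_{3,5}-E_{4,6}$, $\rho(\epsilon_3)=-E_{1,6}+E_{2,5}-E_{3,8}+E_{4,7}$, $\rho(\epsilon_4)=-E_{1,5}-E_{2,6}-E_{3,7}-E_{4,8}$, $\rho(\epsilon_5)=-E_{1,3}-E_{2,4}+E_{5,7}+E_{6,8}$, $\rho(\epsilon_6)=E_{1,4}-E_{2,3}-E_{5,8}+E_{6,7}$, $\rho(\epsilon_7)=E_{1,2}-E_{3,4}-E_{5,6}+E_{7,8}$. Put $r_{ij}=\rho(\epsilon_i)\rho(\epsilon_j)$, $\mathfrak{spin}(7)=\mathrm{span}_{\mathbb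 R}\{r_{ij}\}_{i<j}$ and $B_0(X_1,X_2)=-\mathrm{Re}\,\mathrm{tr}(X_1X_2)$. $\mathfrak h=\mathfrak g_2$ is the subalgebra of all $\sum_{i<j}\omega_{ij}r_{ij}$ with $\omega_{12}+\omega_{34}+\omega_{56}=0$, $-\omega_{13}+\omega_{24}-\omega_{67}=0$, $-\omega_{14}-\omega_{23}-\omega_{57}=0$, $-\omega_{16}-\omega_{25}+\omega_{37}=0$, $\omega_{15}-\omega_{26}-\omega_{47}=0$, $\omega_{17}+\omega_{36}+\omega_{45}=0$, $\omega_{27}+\omega_{35}-\omega_{46}=0$. $\mathfrak m=\mathfrak h^{\perp_{B_0}}$ has $g$-orthonormal basis $e_1=\frac{r_{12}+r_{34}+r_{56}}{2\sqrt6}$, $e_2=\frac{r_{13}-r_{24}+r_{67}}{2\sqrt6}$, $e_3=\frac{r_{14}+r_{23}+r_{57}}{2\sqrt6}$, $e_4=\frac{-r_{15}+r_{26}+r_{47}}{2\sqrt6}$, $e_5=-\frac{r_{16}+r_{25}-r_{37}}{2\sqrt6}$, $e_6=\frac{r_{17}+r_{36}+r_{45}}{2\sqrt6}$, $e_7=-\frac{r_{27}+r_{35}-r_{46}}{2\sqrt6}$. Spin module: $x_j=\frac1{\sqrt2}(e_{2j}-ie_{2j+1})$, $y_j=\frac1{\sqrt2}(e_{2j}+ie_{2j+1})$ ($j=1,2,3$), $\Sigma=\Lambda^\bullet\mathrm{span}_{\mathbb C}\{y_1,y_2,y_3\}$, $e_{2j}\cdot\eta=i(x_j\lrcorner\eta+y_j\wedge\eta)$,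 $e_{2j+1}\cdot\eta=y_j\wedge\eta-x_j\lrcorner\eta$, $e_1\cdot\eta=i\eta$ (even degree), $-i\eta$ (odd degree), $x_j\lrcorner$ the antiderivation with $x_j\lrcorner y_k=\delta_{jk}$. The spin lift of $e_i\wedge e_j$ ($e_i\mapsto e_j$, $e_j\mapsto-e_i$) is $\frac12e_i\cdot e_j$. $\Sigma_{\mathrm{inv}}=\{\psi\in\Sigma:\widetilde{\mathrm{ad}(h)|_{\mathfrak m}}\cdot\psi=0\ \forall h\in\mathfrak h\}$ (constant $H$-equivariant maps $G\to\Sigma$). For $\psi\in\Sigma_{\mathrm{inv}}$, at the origin $\nabla^g_X\psi=\widetilde{\Lambda^g(X)}\cdot\psi$ with $\Lambda^g(X)Y=\frac12[X,Y]_{\mathfrak m}+U(X,Y)$, $2g(U(X,Y),Z)=g([Z,X]_{\mathfrak m},Y)+g(X,[Z,Y]_{\mathfrak m})$ (here $U=0$). *)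

theory Defs
  imports "HOL-Analysis.Analysis"
begin

section \<open>The Lie algebra \<open>spin(7)\<close> and the reductive splitting \<open>h + m\<close>\<close>

text \<open>Rows and columns carry the labels \<open>1, \<dots>, 8\<close> of the type \<open>8\<close> of integers modulo \<open>8\<close>,
  where \<open>8 = 0\<close>.\<close>

type_synonym mat8 = "real^8^8"

definition E :: "8 \<Rightarrow> 8 \<Rightarrow> mat8" where
  "E i j = (\<chi> a b. if a = i \<and> b = j then -1 else if a = j \<and> b = i then 1 else 0)"

definition rho :: "nat \<Rightarrow> mat8" where
  "rho k =
    (if k = 1 then   E 1 8 + E 2 7 - E 3 6 - E 4 5
     else if k = 2 then - E 1 7 + E 2 8 + E 3 5 - E 4 6
     else if k = 3 then - E 1 6 + E 2 5 - E 3 8 + E 4 7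
     else if k = 4 then - E 1 5 - E 2 6 - E 3 7 - E 4 8
     else if k = 5 then - E 1 3 - E 2 4 + E 5 7 + E 6 8
     else if k = 6 then   E 1 4 - E 2 3 - E 5 8 + E 6 7
     else if k = 7 then   E 1 2 - E 3 4 - E 5 6 + E 7 8
     else 0)"

definition r :: "nat \<Rightarrow> nat \<Rightarrow> mat8" where
  "r i j = rho i ** rho j"

definition pairs7 :: "(nat \<times> nat) set" where
  "pairs7 = {(i, j). 1 \<le> i \<and> i < j \<and> j \<le> 7}"

definition spin7 :: "mat8 set" where
  "spin7 = span ((\<lambda>(i, j). r i j) ` pairs7)"

definition bracket :: "mat8 \<Rightarrow> mat8 \<Rightarrow> mat8" where
  "bracket X Y = X ** Y - Y ** X"

definition B0 :: "mat8 \<Rightarrow> mat8 \<Rightarrow> real" where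
  "B0 X Y = - trace (X ** Y)"

definition h_alg :: "mat8 set" where
  "h_alg = {(\<Sum>(i, j)\<in>pairs7. \<omega> i j *\<^sub>R r i j) | \<omega> :: nat \<Rightarrow> nat \<Rightarrow> real.
      \<omega> 1 2 + \<omega> 3 4 + \<omega> 5 6 = 0 \<and>
      - \<omega> 1 3 + \<omega> 2 4 - \<omega> 6 7 = 0 \<and>
      - \<omega> 1 4 - \<omega> 2 3 - \<omega> 5 7 = 0 \<and>
      - \<omega> 1 6 - \<omega> 2 5 + \<omega> 3 7 = 0 \<and>
      \<omega> 1 5 - \<omega> 2 6 - \<omega> 4 7 = 0 \<and>
      \<omega> 1 7 + \<omega> 3 6 + \<omega> 4 5 = 0 \<and>
      \<omega> 2 7 + \<omega> 3 5 - \<omega> 4 6 = 0}"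

definition m_space :: "mat8 set" where
  "m_space = {X \<in> spin7. \<forall>h\<in>h_alg. B0 X h = 0}"

definition e :: "nat \<Rightarrow> mat8" where
  "e k = (1 / (2 * sqrt 6)) *\<^sub>R
    (if k = 1 then   r 1 2 + r 3 4 + r 5 6
     else if k = 2 then r 1 3 - r 2 4 + r 6 7
     else if k = 3 then r 1 4 + r 2 3 + r 5 7
     else if k = 4 then - r 1 5 + r 2 6 + r 4 7
     else if k = 5 then - (r 1 6 + r 2 5 - r 3 7)
     else if k = 6 then r 1 7 + r 3 6 + r 4 5
     else if k = 7 then - (r 2 7 + r 3 5 - r 4 6)
     else 0)"

text \<open>The invariant metric on \<open>m\<close>; only used with both arguments in \<open>m\<close>.\<close>

abbreviation g :: "mat8 \<Rightarrow> mat8 \<Rightarrow> real" where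
  "g \<equiv> B0"

text \<open>The component \<open>X\<^sub>m\<close> of \<open>X \<in> spin(7) = h \<oplus> m\<close>.\<close>

definition m_part :: "mat8 \<Rightarrow> mat8" where
  "m_part X = (THE Z. Z \<in> m_space \<and> X - Z \<in> h_alg)"

definition U :: "mat8 \<Rightarrow> mat8 \<Rightarrow> mat8" where
  "U X Y = (THE W. W \<in> m_space \<and> (\<forall>Z\<in>m_space.
      2 * g W Z = g (m_part (bracket Z X)) Y + g X (m_part (bracket Z Y))))"

text \<open>The Nomizu map of the Levi-Civita connection of \<open>g\<close>.\<close>

definition Lambda_g :: "mat8 \<Rightarrow> mat8 \<Rightarrow> mat8" where
  "Lambda_g X Y = (1/2) *\<^sub>R m_part (bracket X Y) + U X Y"


section \<open>The spin module\<close>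

text \<open>The exterior algebra of the complex vector space with basis \<open>y\<^sub>1, y\<^sub>2, y\<^sub>3\<close>:
  the coordinate at \<open>S\<close> is the coefficient of the wedge product of the \<open>y\<^sub>j\<close>, \<open>j \<in> S\<close>, taken
  in increasing order of \<open>j\<close>. In the type \<open>3\<close> one has \<open>3 = 0\<close>, so its built-in order does not
  give \<open>1 < 2 < 3\<close>; the function \<open>lbl\<close> does.\<close>

type_synonym spinor = "complex^(3 set)"

definition lbl :: "3 \<Rightarrow> nat" where
  "lbl j = (if j = 1 then 1 else if j = 2 then 2 else 3)"

definition shuffle_sign :: "3 set \<Rightarrow> 3 set \<Rightarrow> complex" where
  "shuffle_sign S T = (-1) ^ card {(s, t). s \<in> S \<and> t \<in> T \<and> lbl t < lbl s}"

definition wedge :: "spinor \<Rightarrow> spinor \<Rightarrow> spinor" (infixr \<open>\<and>\<^sub>\<Lambda>\<close> 75) where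
  "\<alpha> \<and>\<^sub>\<Lambda> \<beta> = (\<chi> V. \<Sum>S\<in>Pow V. shuffle_sign S (V - S) * \<alpha> $ S * \<beta> $ (V - S))"

definition one_form :: spinor (\<open>\<one>\<^sub>\<Lambda>\<close>) where
  "\<one>\<^sub>\<Lambda> = axis {} 1"

definition y :: "3 \<Rightarrow> spinor" where
  "y j = axis {j} 1"

definition below :: "3 \<Rightarrow> 3 set \<Rightarrow> nat" where
  "below j V = card {t \<in> V. lbl t < lbl j}"

text \<open>Contraction with \<open>x\<^sub>j\<close>. That it is the antiderivation with \<open>x\<^sub>j\<close> contracted into \<open>y\<^sub>k\<close>
  equal to \<open>\<delta>\<^sub>j\<^sub>k\<close> is checked in \<open>contr_one\<close> and \<open>contr_wedge_y\<close> below.\<close>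

definition contr :: "3 \<Rightarrow> spinor \<Rightarrow> spinor" where
  "contr j \<eta> = (\<chi> V. if j \<in> V then 0
      else (-1) ^ below j V * \<eta> $ (insert j V))"

text \<open>Clifford multiplication by the basis vector \<open>e k\<close>, for \<open>1 \<le> k \<le> 7\<close>.\<close>

definition cliff_e :: "nat \<Rightarrow> spinor \<Rightarrow> spinor" where
  "cliff_e k \<eta> =
    (if k = 1 then (\<chi> S. (if even (card S) then \<i> else - \<i>) * \<eta> $ S)
     else let j = of_nat (k div 2) :: 3 in
       if even k then \<i> *s (contr j \<eta> + y j \<and>\<^sub>\<Lambda> \<eta>)
       else y j \<and>\<^sub>\<Lambda> \<eta> - contr j \<eta>)"

definition cliff :: "mat8 \<Rightarrow> spinor \<Rightarrow> spinor" where
  "cliff X \<eta> = (\<Sum>k\<in>{1..7}. complex_of_real (g X (e k)) *s cliff_e k \<eta>)"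

text \<open>The action on spinors of the spin lift of a skew endomorphism \<open>A\<close> of \<open>m\<close>: write
  \<open>A = (\<Sum>i<j. a i j (e i \<and> e j))\<close>, where \<open>e i \<and> e j\<close> maps \<open>e i\<close> to \<open>e j\<close> and \<open>e j\<close> to \<open>- e i\<close>, so
  that \<open>a i j = g (A (e i)) (e j)\<close>, and send \<open>e i \<and> e j\<close> to \<open>1/2 e i \<cdot> e j\<close>.\<close>

definition spin_lift :: "(mat8 \<Rightarrow> mat8) \<Rightarrow> spinor \<Rightarrow> spinor" where
  "spin_lift A \<eta> = (\<Sum>(i, j)\<in>pairs7.
      (complex_of_real (g (A (e i)) (e j)) * (1/2)) *s cliff_e i (cliff_e j \<eta>))"

definition Sigma_inv :: "spinor set" where
  "Sigma_inv = {\<psi>. \<forall>h\<in>h_alg. spin_lift (bracket h) \<psi> = 0}"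

text \<open>The Levi-Civita spinor derivative at the origin of an invariant spinor \<open>\<psi>\<close>, in direction
  \<open>X \<in> m\<close>.\<close>

definition nabla :: "mat8 \<Rightarrow> spinor \<Rightarrow> spinor" where
  "nabla X \<psi> = spin_lift (Lambda_g X) \<psi>"


section \<open>Consistency of the exterior algebra\<close>

lemma lbl_inj: "lbl j = lbl k \<longleftrightarrow> j = k"
  using exhaust_3[of j] exhaust_3[of k] by (auto simp: lbl_def)

lemma below_insert:
  "below j (insert k V) = below j V + (if k \<notin> V \<and> lbl k < lbl j then 1 else 0)"
proof -
  have "{t \<in> insert k V. lbl t < lbl j} =
      (if lbl k < lbl j then insert k {t \<in> V. lbl t < lbl j} else {t \<in> V. lbl t < lbl j})"
    by auto
  then show ?thesis by (simp add: below_def insert_absorb)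
qed

lemma below_empty: "below j {} = 0"
  by (simp add: below_def)

lemma y_wedge_nth:
  "(y k \<and>\<^sub>\<Lambda> \<eta>) $ V =
    (if k \<in> V then (-1) ^ below k V * \<eta> $ (V - {k}) else 0)"
proof -
  have "(y k \<and>\<^sub>\<Lambda> \<eta>) $ V =
      (\<Sum>S\<in>Pow V. if S = {k} then shuffle_sign {k} (V - {k}) * \<eta> $ (V - {k}) else 0)"
    unfolding wedge_def y_def axis_def vec_lambda_beta by (rule sum.cong) auto
  also have "\<dots> = (if k \<in> V then shuffle_sign {k} (V - {k}) * \<eta> $ (V - {k}) else 0)"
    by (simp add: sum.delta)
  finally have *: "(y k \<and>\<^sub>\<Lambda> \<eta>) $ V = \<dots>" .
  have "{(s, t). s \<in> {k} \<and> t \<in> V - {k} \<and> lbl t < lbl s} = Pair k ` {t \<in> V. lbl t < lbl k}"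
    by auto
  then have "card {(s, t). s \<in> {k} \<and> t \<in> V - {k} \<and> lbl t < lbl s} = card {t \<in> V. lbl t < lbl k}"
    by (simp add: card_image inj_on_def)
  with * show ?thesis by (simp add: shuffle_sign_def below_def)
qed

lemma contr_one: "contr j \<one>\<^sub>\<Lambda> = 0"
  by (auto simp: contr_def one_form_def axis_def vec_eq_iff)

lemma wedge_one: "y k \<and>\<^sub>\<Lambda> \<one>\<^sub>\<Lambda> = y k"
proof -
  have "(y k \<and>\<^sub>\<Lambda> \<one>\<^sub>\<Lambda>) $ V = y k $ V" for V
  proof (cases "V = {k}")
    case True
    then show ?thesis
      unfolding y_wedge_nth by (simp add: below_insert below_empty one_form_def y_def axis_def)
  next
    case False
    then show ?thesis
      unfolding y_wedge_nth by (auto simp: one_form_def y_def axis_def)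
  qed
  then show ?thesis by (simp add: vec_eq_iff)
qed

lemma contr_wedge_y:
  "contr j (y k \<and>\<^sub>\<Lambda> \<eta>) = (if j = k then \<eta> else 0) - y k \<and>\<^sub>\<Lambda> contr j \<eta>"
proof (cases "j = k")
  case True
  have *: "contr k (y k \<and>\<^sub>\<Lambda> \<eta>) $ V + (y k \<and>\<^sub>\<Lambda> contr k \<eta>) $ V = \<eta> $ V" for V
  proof (cases "k \<in> V")
    case kV: True
    then have "insert k (V - {k}) = V" by auto
    moreover have "below k (V - {k}) = below k V"
      using below_insert[of k k "V - {k}"] kV by (simp add: insert_absorb)
    moreover have "k \<notin> V - {k}" by simp
    ultimately show ?thesis using kV
      by (simp add: contr_def y_wedge_nth flip: power_add mult.assoc mult_2)
  next
    case False
    then show ?thesis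
      by (simp add: contr_def y_wedge_nth below_insert flip: power_add mult.assoc mult_2)
  qed
  show ?thesis using True * by (simp add: vec_eq_iff eq_diff_eq)
next
  case False
  have "contr j (y k \<and>\<^sub>\<Lambda> \<eta>) $ V + (y k \<and>\<^sub>\<Lambda> contr j \<eta>) $ V = 0" for V
  proof (cases "k \<in> V \<and> j \<notin> V")
    case True
    define W where "W = V - {k}"
    have V: "V = insert k W" and W: "k \<notin> W" "j \<notin> W" using True by (auto simp: W_def)
    have ne: "insert j (insert k W) - {k} = insert j W" "insert j (insert k W) = insert k (insert j W)"
      "insert k W - {k} = W"
      using W False by auto
    have o: "lbl k < lbl j \<longleftrightarrow> \<not> lbl j < lbl k"
      using False lbl_inj[of j k] by auto
    show ?thesis using W False ne unfolding V
      by (cases "lbl j < lbl k")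
         (simp_all add: contr_def y_wedge_nth below_insert o insert_Diff_if)
  next
    case c: False
    then show ?thesis using False by (auto simp: contr_def y_wedge_nth)
  qed
  then show ?thesis using False by (simp add: vec_eq_iff eq_neg_iff_add_eq_0)
qed

end

theory Submission
  imports Defs
begin

text \<open>Clifford multiplication by the basis of \<open>m\<close> closes up on the spinor
  \<open>\<psi> = - 1 + y\<^sub>1 \<and> y\<^sub>2 \<and> y\<^sub>3\<close>: for \<open>i \<noteq> j\<close> one has \<open>e\<^sub>i \<cdot> e\<^sub>j \<cdot> \<psi> = \<Sum>\<^sub>k \<phi>\<^sub>i\<^sub>j\<^sub>k e\<^sub>k \<cdot> \<psi>\<close>, where \<open>\<phi>\<close> is the
  \<open>G\<^sub>2\<close>-invariant three-form, given by an oriented Fano plane (lemma \<open>cliff_e_cliff_e_psi0\<close>).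
  So the spin lift of a skew endomorphism \<open>A = \<Sum>\<^sub>i\<^sub><\<^sub>j a\<^sub>i\<^sub>j e\<^sub>i \<and> e\<^sub>j\<close> acts on \<open>\<psi>\<close> as Clifford
  multiplication by the vector \<open>1/2 \<Sum>\<^sub>k (\<Sum>\<^sub>i\<^sub><\<^sub>j \<phi>\<^sub>i\<^sub>j\<^sub>k a\<^sub>i\<^sub>j) e\<^sub>k\<close> (lemma \<open>spin_lift_psi0\<close>).

  Both claims about \<open>\<psi>\<close> concern endomorphisms with \<open>a\<^sub>i\<^sub>j\<close> proportional to \<open>B\<^sub>0(X, [e\<^sub>i, e\<^sub>j])\<close>.
  For \<open>A = ad(h)\<close> this is the invariance of \<open>B\<^sub>0\<close>, with \<open>X = h\<close> and factor \<open>1\<close>; for the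
  Levi-Civita connection \<open>A = \<Lambda>\<^sup>g(X)\<close> invariance also gives \<open>U = 0\<close>, and the factor is \<open>1/2\<close>
  (lemma \<open>B0_Lambda_g\<close>). One identity evaluates the vector in both cases, namely
  \<open>\<Sum>\<^sub>i\<^sub><\<^sub>j \<phi>\<^sub>i\<^sub>j\<^sub>k [e\<^sub>i, e\<^sub>j] = \<surd>(3/2) e\<^sub>k\<close> (lemma \<open>phi_bracket_e\<close>): the \<open>h\<close>-components of the three
  brackets on the lines through \<open>k\<close> cancel. As \<open>h\<close> is orthogonal to every \<open>e\<^sub>k\<close>, it annihilates
  \<open>\<psi>\<close>; and for \<open>X \<in> m\<close> the derivative is \<open>1/2 \<cdot> 1/2 \<cdot> \<surd>(3/2) X \<cdot> \<psi>\<close>, which is the stated Killing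
  equation.

  That every invariant spinor is a multiple of \<open>\<psi>\<close> follows from three elements of \<open>h\<close>. Each of them
  rotates two coordinate planes of \<open>m\<close> with opposite speeds, so that it annihilates \<open>\<eta>\<close> if and
  only if \<open>e\<^sub>a \<cdot> e\<^sub>b \<cdot> \<eta> = e\<^sub>c \<cdot> e\<^sub>d \<cdot> \<eta>\<close> for these planes. Two of them span a Cartan subalgebra of
  \<open>h\<close>, which acts diagonally on the wedge products of the \<open>y\<^sub>j\<close> and leaves only the degrees
  \<open>0\<close> and \<open>3\<close>; the third relates the two remaining coefficients.\<close>

(* With 1 kept as a numeral, facts about the index 1 have the same form as those about 2, ..., 7. *)
declare One_nat_def [simp del]

section \<open>Bilinearity and invariance of the bracket and of \<open>B\<^sub>0\<close>\<close>

lemma matrix_add_rdistrib: "(A + B) ** C = A ** C + B ** (C :: mat8)"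
  by (simp add: matrix_matrix_mult_def vec_eq_iff sum.distrib distrib_right)

interpretation mat_mult: bounded_bilinear "(**) :: mat8 \<Rightarrow> mat8 \<Rightarrow> mat8"
  unfolding bilinear_conv_bounded_bilinear[symmetric] bilinear_def
  by (intro conjI allI linearI)
     (simp_all add: matrix_add_ldistrib matrix_add_rdistrib matrix_scalar_ac scalar_matrix_assoc)

lemmas mult_linear = mat_mult.diff_left mat_mult.diff_right mat_mult.minus_left mat_mult.minus_right
  mat_mult.scaleR_left mat_mult.scaleR_right

interpretation mat_vec: bounded_bilinear "(*v) :: mat8 \<Rightarrow> real^8 \<Rightarrow> real^8"
  unfolding bilinear_conv_bounded_bilinear[symmetric] bilinear_def
  by (intro conjI allI linearI)
     (simp_all add: matrix_vector_right_distrib matrix_vector_mult_add_rdistrib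
        scaleR_matrix_vector_assoc matrix_vector_mult_scaleR)

interpretation bracket: bounded_bilinear bracket
  unfolding bilinear_conv_bounded_bilinear[symmetric] bilinear_def bracket_def
  by (intro conjI allI linearI)
     (simp_all add: mat_mult.add_left mat_mult.add_right mat_mult.scaleR_left mat_mult.scaleR_right
       algebra_simps)

lemmas bracket_linear = bracket.add_left bracket.add_right bracket.diff_left bracket.diff_right
  bracket.minus_left bracket.minus_right bracket.scaleR_left bracket.scaleR_right

lemma trace_scaleR: "trace (c *\<^sub>R A) = c * trace (A :: real^'n^'n)"
  by (simp add: trace_def sum_distrib_left)

lemma trace_minus: "trace (- A) = - trace (A :: real^'n^'n)"
  by (simp add: trace_def sum_negf)

interpretation B0: bounded_bilinear B0
  unfolding bilinear_conv_bounded_bilinear[symmetric] bilinear_def B0_def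
  by (intro conjI allI linearI)
     (simp_all add: mat_mult.add_left mat_mult.add_right mat_mult.scaleR_left mat_mult.scaleR_right
       trace_add trace_scaleR)

lemmas B0_linear = B0.add_left B0.add_right B0.diff_left B0.diff_right B0.minus_left B0.minus_right
  B0.scaleR_left B0.scaleR_right

lemma B0_commute: "B0 X Y = B0 Y X"
  by (simp add: B0_def trace_mul_sym[of X])

text \<open>Invariance of \<open>B\<^sub>0\<close> under the adjoint action, from the cyclicity of the trace. It turns the
  matrix entries \<open>g([X, e\<^sub>i], e\<^sub>j)\<close> of \<open>ad(X)\<close> into \<open>g(X, [e\<^sub>i, e\<^sub>j])\<close>.\<close>

lemma B0_bracket: "B0 (bracket X Y) Z = B0 X (bracket Y Z)"
proof -
  have "trace (Y ** X ** Z) = trace (X ** (Z ** Y))"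
    by (metis matrix_mul_assoc trace_mul_sym)
  then show ?thesis
    by (simp add: B0_def bracket_def mat_mult.diff_left mat_mult.diff_right trace_sub matrix_mul_assoc)
qed

section \<open>Clifford relations and the brackets of the \<open>r\<^sub>i\<^sub>j\<close>\<close>

lemma UNIV_8: "(UNIV :: 8 set) = {1,2,3,4,5,6,7,8}"
proof -
  have "card {1,2,3,4,5,6,7,8::8} = card (UNIV::8 set)" by simp
  then show ?thesis by (intro sym[OF card_subset_eq]) auto
qed

lemma forall_8: "(\<forall>i::8. P i) \<longleftrightarrow> P 1 \<and> P 2 \<and> P 3 \<and> P 4 \<and> P 5 \<and> P 6 \<and> P 7 \<and> P 8"
proof -
  have "(\<forall>i. P i) \<longleftrightarrow> (\<forall>i\<in>{1,2,3,4,5,6,7,8}. P i)"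
    unfolding UNIV_8[symmetric] by simp
  then show ?thesis by simp
qed

lemma nat_1_7: "i \<in> {1..7::nat} \<longleftrightarrow> i = 1 \<or> i = 2 \<or> i = 3 \<or> i = 4 \<or> i = 5 \<or> i = 6 \<or> i = 7"
  by auto

lemma atLeastAtMost_1_7: "{1..7} = {1,2,3,4,5,6,7::nat}"
  by (rule set_eqI) (simp only: nat_1_7 insert_iff empty_iff simp_thms)

lemma E_mult_vec:
  assumes "i \<noteq> j"
  shows "(E i j *v x) $ a = (if a = j then x $ i else if a = i then - x $ j else 0)"
proof -
  have "(E i j *v x) $ a = (\<Sum>b\<in>UNIV. (if b = i then (if a = j then x $ b else 0) else 0)
      - (if b = j then (if a = i then x $ b else 0) else 0))"
    unfolding matrix_vector_mult_def E_def using assms by (auto intro!: sum.cong)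
  then show ?thesis using assms by (simp add: sum_subtractf)
qed

text \<open>Every \<open>\<rho>(\<epsilon>\<^sub>k)\<close> is a signed permutation matrix. In this form products of two of them are
  composed entry by entry, without sums over the eight indices.\<close>

lemma rho_vec:
  "(rho 1 *v x) $ 1 = - x $ 8" "(rho 1 *v x) $ 2 = - x $ 7" "(rho 1 *v x) $ 3 = x $ 6" "(rho 1 *v x) $ 4 = x $ 5"
  "(rho 1 *v x) $ 5 = - x $ 4" "(rho 1 *v x) $ 6 = - x $ 3" "(rho 1 *v x) $ 7 = x $ 2" "(rho 1 *v x) $ 8 = x $ 1"
  "(rho 2 *v x) $ 1 = x $ 7" "(rho 2 *v x) $ 2 = - x $ 8" "(rho 2 *v x) $ 3 = - x $ 5" "(rho 2 *v x) $ 4 = x $ 6"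
  "(rho 2 *v x) $ 5 = x $ 3" "(rho 2 *v x) $ 6 = - x $ 4" "(rho 2 *v x) $ 7 = - x $ 1" "(rho 2 *v x) $ 8 = x $ 2"
  "(rho 3 *v x) $ 1 = x $ 6" "(rho 3 *v x) $ 2 = - x $ 5" "(rho 3 *v x) $ 3 = x $ 8" "(rho 3 *v x) $ 4 = - x $ 7"
  "(rho 3 *v x) $ 5 = x $ 2" "(rho 3 *v x) $ 6 = - x $ 1" "(rho 3 *v x) $ 7 = x $ 4" "(rho 3 *v x) $ 8 = - x $ 3"
  "(rho 4 *v x) $ 1 = x $ 5" "(rho 4 *v x) $ 2 = x $ 6" "(rho 4 *v x) $ 3 = x $ 7" "(rho 4 *v x) $ 4 = x $ 8"
  "(rho 4 *v x) $ 5 = - x $ 1" "(rho 4 *v x) $ 6 = - x $ 2" "(rho 4 *v x) $ 7 = - x $ 3" "(rho 4 *v x) $ 8 = - x $ 4"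
  "(rho 5 *v x) $ 1 = x $ 3" "(rho 5 *v x) $ 2 = x $ 4" "(rho 5 *v x) $ 3 = - x $ 1" "(rho 5 *v x) $ 4 = - x $ 2"
  "(rho 5 *v x) $ 5 = - x $ 7" "(rho 5 *v x) $ 6 = - x $ 8" "(rho 5 *v x) $ 7 = x $ 5" "(rho 5 *v x) $ 8 = x $ 6"
  "(rho 6 *v x) $ 1 = - x $ 4" "(rho 6 *v x) $ 2 = x $ 3" "(rho 6 *v x) $ 3 = - x $ 2" "(rho 6 *v x) $ 4 = x $ 1"
  "(rho 6 *v x) $ 5 = x $ 8" "(rho 6 *v x) $ 6 = - x $ 7" "(rho 6 *v x) $ 7 = x $ 6" "(rho 6 *v x) $ 8 = - x $ 5"
  "(rho 7 *v x) $ 1 = - x $ 2" "(rho 7 *v x) $ 2 = x $ 1" "(rho 7 *v x) $ 3 = x $ 4" "(rho 7 *v x) $ 4 = - x $ 3"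
  "(rho 7 *v x) $ 5 = x $ 6" "(rho 7 *v x) $ 6 = - x $ 5" "(rho 7 *v x) $ 7 = - x $ 8" "(rho 7 *v x) $ 8 = x $ 7"
  by (simp_all add: rho_def mat_vec.add_left mat_vec.diff_left mat_vec.minus_left E_mult_vec)

lemma rho_anticommute_vec:
  assumes "i \<in> {1..7}" "j \<in> {1..7}"
  shows "rho i *v (rho j *v x) + rho j *v (rho i *v x) = - (if i = j then 2 else 0) *\<^sub>R x"
proof -
  have "\<forall>i\<in>{1,2,3,4,5,6,7}. \<forall>j\<in>{1,2,3,4,5,6,7}.
    rho i *v (rho j *v x) + rho j *v (rho i *v x) = - (if i = j then 2 else 0) *\<^sub>R x"
    by (simp add: vec_eq_iff forall_8 rho_vec)
  then show ?thesis using assms unfolding nat_1_7 by blast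
qed

lemma rho_anticommute:
  assumes "i \<in> {1..7}" "j \<in> {1..7}"
  shows "rho i ** rho j = - (if i = j then 2 else 0) *\<^sub>R mat 1 - rho j ** rho i"
proof -
  have "rho i *v (rho j *v x) + rho j *v (rho i *v x) = - (if i = j then 2 else 0) *\<^sub>R x" for x
    using assms by (rule rho_anticommute_vec)
  then have "rho i ** rho j + rho j ** rho i = - (if i = j then 2 else 0) *\<^sub>R mat 1"
    unfolding matrix_eq
    by (simp add: mat_vec.add_left mat_vec.scaleR_left mat_vec.minus_left
        matrix_vector_mul_assoc)
  then show ?thesis by (simp only: eq_diff_eq)
qed

lemma r_swap:
  assumes "i \<in> {1..7}" "j \<in> {1..7}"
  shows "r i j = - (if i = j then 2 else 0) *\<^sub>R mat 1 - r j i"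
  using rho_anticommute[OF assms] by (simp add: r_def)

lemma r_same: "i \<in> {1..7} \<Longrightarrow> r i i = - mat 1"
proof -
  assume "i \<in> {1..7}"
  from r_swap[OF this this] have "r i i + r i i = - mat 1 + - mat 1"
    by (simp only: eq_diff_eq) (simp add: scaleR_2)
  then show ?thesis by (simp only: scaleR_2[symmetric] scaleR_cancel_left) simp
qed

lemma r_descending:
  assumes "i \<in> {1..7}" "j \<in> {1..7}" "j < i"
  shows "r i j = - r j i"
  using r_swap[of i j] assms by simp

lemma trace_r:
  assumes "i \<in> {1..7}" "j \<in> {1..7}"
  shows "trace (r i j) = (if i = j then -8 else 0)"
proof -
  have "trace (r i j) = trace (- (if i = j then 2 else 0) *\<^sub>R mat 1 - r i j)"
    using arg_cong[OF r_swap[OF assms], of trace] trace_mul_sym[of "rho i" "rho j"]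
    by (simp add: r_def trace_sub)
  then show ?thesis by (auto simp: trace_sub trace_minus trace_scaleR trace_I split: if_splits)
qed

text \<open>Moving \<open>\<rho>(\<epsilon>\<^sub>i)\<close> from the front of a fourfold product to its end changes the sign three times.
  Under the trace the last term equals minus the left-hand side, so that traces of fourfold
  products reduce to traces of twofold ones.\<close>

lemma r_mult_r_cyclic:
  assumes "i \<in> {1..7}" "j \<in> {1..7}" "k \<in> {1..7}" "l \<in> {1..7}"
  shows "r i j ** r k l = - (if i = j then 2 else 0) *\<^sub>R r k l + (if i = k then 2 else 0) *\<^sub>R r j l
    + - (if i = l then 2 else 0) *\<^sub>R r j k - rho j ** r k l ** rho i"
proof -
  have "rho i ** rho j ** rho k ** rho l = - (if i = j then 2 else 0) *\<^sub>R (rho k ** rho l)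
      - rho j ** (rho i ** rho k) ** rho l"
    using assms by (subst rho_anticommute[of i j])
      (simp_all del: if_split add: mult_linear matrix_mul_assoc)
  also have "rho j ** (rho i ** rho k) ** rho l = - (if i = k then 2 else 0) *\<^sub>R (rho j ** rho l)
      - rho j ** rho k ** (rho i ** rho l)"
    using assms by (subst rho_anticommute[of i k])
      (simp_all del: if_split add: mult_linear matrix_mul_assoc)
  also have "rho j ** rho k ** (rho i ** rho l) = - (if i = l then 2 else 0) *\<^sub>R (rho j ** rho k)
      - rho j ** rho k ** rho l ** rho i"
    using assms by (subst rho_anticommute[of i l])
      (simp_all del: if_split add: mult_linear matrix_mul_assoc)
  finally show ?thesis by (simp add: r_def matrix_mul_assoc)
qed

lemma B0_r:
  assumes "i \<in> {1..7}" "j \<in> {1..7}" "k \<in> {1..7}" "l \<in> {1..7}"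
  shows "B0 (r i j) (r k l) = (if i = k \<and> j = l then 8 else 0) - (if i = j \<and> k = l then 8 else 0)
    - (if i = l \<and> j = k then 8 else 0)"
proof -
  have "trace (rho j ** r k l ** rho i) = trace (r i j ** r k l)"
    unfolding trace_mul_sym[of "rho j ** r k l" "rho i"] by (simp add: r_def matrix_mul_assoc)
  then have "2 * trace (r i j ** r k l) = - (if i = j then 2 else 0) * trace (r k l)
     + (if i = k then 2 else 0) * trace (r j l) + - (if i = l then 2 else 0) * trace (r j k)"
    using arg_cong[OF r_mult_r_cyclic[OF assms], of trace]
    by (simp add: trace_add trace_sub trace_minus trace_scaleR)
  then show ?thesis using assms by (auto simp: trace_r B0_def)
qed

text \<open>The commutation relations of \<open>so(7)\<close>, from moving \<open>\<rho>(\<epsilon>\<^sub>k)\<rho>(\<epsilon>\<^sub>l)\<close> to the front past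
  \<open>\<rho>(\<epsilon>\<^sub>j)\<close> and then past \<open>\<rho>(\<epsilon>\<^sub>i)\<close>. For coinciding indices the terms \<open>r\<^sub>i\<^sub>i = - 1\<close> are included and
  cancel.\<close>

lemma bracket_r:
  assumes "i \<in> {1..7}" "j \<in> {1..7}" "k \<in> {1..7}" "l \<in> {1..7}"
  shows "bracket (r i j) (r k l) = - (if j = k then 2 else 0) *\<^sub>R r i l
    + (if j = l then 2 else 0) *\<^sub>R r i k + - (if i = k then 2 else 0) *\<^sub>R r l j
    + (if i = l then 2 else 0) *\<^sub>R r k j"
proof -
  have "r i j ** r k l = rho i ** (rho j ** rho k) ** rho l" by (simp add: r_def matrix_mul_assoc)
  also have "\<dots> = - (if j = k then 2 else 0) *\<^sub>R r i l - rho i ** rho k ** (rho j ** rho l)"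
    using assms by (subst rho_anticommute[of j k])
      (simp_all del: if_split add: r_def mult_linear matrix_mul_assoc)
  also have "rho i ** rho k ** (rho j ** rho l) = - (if j = l then 2 else 0) *\<^sub>R r i k
      - rho i ** rho k ** rho l ** rho j"
    using assms by (subst rho_anticommute[of j l])
      (simp_all del: if_split add: r_def mult_linear matrix_mul_assoc)
  also have "rho i ** rho k ** rho l ** rho j = - (if i = k then 2 else 0) *\<^sub>R r l j
      - rho k ** (rho i ** rho l) ** rho j"
    using assms by (subst rho_anticommute[of i k])
      (simp_all del: if_split add: r_def mult_linear matrix_mul_assoc)
  also have "rho k ** (rho i ** rho l) ** rho j = - (if i = l then 2 else 0) *\<^sub>R r k j
      - r k l ** r i j"
    using assms by (subst rho_anticommute[of i l])
      (simp_all del: if_split add: r_def mult_linear matrix_mul_assoc)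
  finally show ?thesis by (simp add: bracket_def algebra_simps del: if_split)
qed

section \<open>The Lie algebra \<open>spin(7)\<close> and its orthogonal basis\<close>

lemma pairs7_eq:
  "pairs7 = {(1,2), (1,3), (1,4), (1,5), (1,6), (1,7), (2,3), (2,4), (2,5), (2,6), (2,7),
    (3,4), (3,5), (3,6), (3,7), (4,5), (4,6), (4,7), (5,6), (5,7), (6,7)}"
proof -
  have "pairs7 = set (filter (\<lambda>(i, j). i < j) (List.product [1..<8] [1..<8]))"
    by (auto simp: pairs7_def)
  then show ?thesis by (simp add: upt_rec numeral_eq_Suc)
qed

lemma pairs7_range: "(i, j) \<in> pairs7 \<Longrightarrow> i \<in> {1..7} \<and> j \<in> {1..7} \<and> i < j"
  by (simp add: pairs7_def)

lemma finite_pairs7: "finite pairs7"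
  by (simp add: pairs7_eq)

lemma subspace_spin7: "subspace spin7"
  by (simp add: spin7_def)

lemma r_in_spin7:
  assumes "i \<in> {1..7}" "j \<in> {1..7}" "i \<noteq> j"
  shows "r i j \<in> spin7"
proof -
  have *: "r i j \<in> spin7" if "i \<in> {1..7}" "j \<in> {1..7}" "i < j" for i j
    unfolding spin7_def using that by (intro span_base) (auto simp: pairs7_def)
  show ?thesis
  proof (cases "i < j")
    case False
    then have "r i j = - r j i" using assms r_descending by simp
    then show ?thesis using *[of j i] assms False subspace_neg[OF subspace_spin7] by simp
  qed (use * assms in blast)
qed

lemma bracket_r_in_spin7:
  assumes "(i, j) \<in> pairs7" "(k, l) \<in> pairs7"
  shows "bracket (r i j) (r k l) \<in> spin7"
proof (cases "i = k \<and> j = l")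
  case True
  then show ?thesis using subspace_0[OF subspace_spin7] by (simp add: bracket_def)
next
  case False
  have *: "(if P then c else 0) *\<^sub>R X \<in> spin7" if "P \<Longrightarrow> X \<in> spin7" for P c X
    using that subspace_scale[OF subspace_spin7] subspace_0[OF subspace_spin7] by simp
  note r = pairs7_range[OF assms(1)] pairs7_range[OF assms(2)]
  have "bracket (r i j) (r k l) = (if j = k then -2 else 0) *\<^sub>R r i l
    + (if j = l then 2 else 0) *\<^sub>R r i k + (if i = k then -2 else 0) *\<^sub>R r l j
    + (if i = l then 2 else 0) *\<^sub>R r k j"
    using r by (subst bracket_r) auto
  also have "\<dots> \<in> spin7"
    using r False by (intro subspace_add[OF subspace_spin7] *) (auto intro!: r_in_spin7)
  finally show ?thesis .
qed

lemma bracket_in_spin7: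
  assumes "X \<in> spin7" "Y \<in> spin7"
  shows "bracket X Y \<in> spin7"
proof -
  have lin: "linear (bracket Z)" "linear (\<lambda>Z. bracket Z Y)" for Z Y
    by (simp_all add: bracket.bounded_linear_left bracket.bounded_linear_right bounded_linear.linear)
  have "bracket (r i j) Y \<in> spin7" if ij: "(i, j) \<in> pairs7" for i j
    using assms(2) unfolding spin7_def
  proof (induction rule: span_induct)
    case base
    show ?case using lin(1) subspace_span by (auto simp flip: vimage_def intro!: linear_subspace_vimage)
  next
    case (step Y)
    then show ?case using bracket_r_in_spin7[OF ij] by (auto simp: spin7_def)
  qed
  note * = this
  show ?thesis
    using assms(1) unfolding spin7_def
  proof (induction rule: span_induct)
    case base
    show ?case using lin(2) subspace_span by (auto simp flip: vimage_def intro!: linear_subspace_vimage)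
  next
    case (step X)
    then show ?case using * by (auto simp: spin7_def)
  qed
qed

lemma B0_sum_r:
  assumes "(i, j) \<in> pairs7"
  shows "B0 (\<Sum>(k, l)\<in>pairs7. \<omega> k l *\<^sub>R r k l) (r i j) = 8 * \<omega> i j"
proof -
  have "B0 (\<Sum>(k, l)\<in>pairs7. \<omega> k l *\<^sub>R r k l) (r i j)
      = (\<Sum>p\<in>pairs7. if p = (i, j) then 8 * \<omega> i j else 0)"
    unfolding B0.sum_left
  proof (rule sum.cong, rule refl, clarify)
    fix k l assume "(k, l) \<in> pairs7"
    from pairs7_range[OF this] pairs7_range[OF assms]
    show "B0 (\<omega> k l *\<^sub>R r k l) (r i j) = (if (k, l) = (i, j) then 8 * \<omega> i j else 0)"
      by (auto simp: B0.scaleR_left B0_r)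
  qed
  then show ?thesis using assms finite_pairs7 by simp
qed

lemma sum_r_in_spin7: "(\<Sum>(k, l)\<in>pairs7. \<omega> k l *\<^sub>R r k l) \<in> spin7"
  using pairs7_range by (auto intro!: subspace_sum subspace_scale subspace_spin7 r_in_spin7)

lemma spin7_expansion:
  assumes "X \<in> spin7"
  shows "X = (\<Sum>(i, j)\<in>pairs7. (B0 X (r i j) / 8) *\<^sub>R r i j)"
  using assms unfolding spin7_def
proof (induction rule: span_induct)
  case base
  let ?F = "\<lambda>X. \<Sum>(i, j)\<in>pairs7. (B0 X (r i j) / 8) *\<^sub>R r i j"
  have "?F (X + Y) = ?F X + ?F Y" "?F (c *\<^sub>R X) = c *\<^sub>R ?F X" "?F 0 = 0" for X Y c
    by (simp_all add: B0.add_left B0.scaleR_left B0.zero_left case_prod_unfold add_divide_distrib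
        scaleR_add_left sum.distrib scaleR_sum_right)
  then show ?case by (intro subspaceI CollectI) (simp_all only: mem_Collect_eq)
next
  case (step X)
  then obtain i j where ij: "(i, j) \<in> pairs7" and X: "X = r i j" by auto
  have "(\<Sum>(k, l)\<in>pairs7. (B0 X (r k l) / 8) *\<^sub>R r k l)
      = (\<Sum>p\<in>pairs7. if p = (i, j) then r i j else 0)"
  proof (rule sum.cong, rule refl, clarify)
    fix k l assume "(k, l) \<in> pairs7"
    from pairs7_range[OF this] pairs7_range[OF ij]
    show "(B0 X (r k l) / 8) *\<^sub>R r k l = (if (k, l) = (i, j) then r i j else 0)"
      by (auto simp: X B0_r)
  qed
  then show ?case using ij finite_pairs7 by (simp add: X)
qed

text \<open>The squared coordinates in the \<open>B\<^sub>0\<close>-orthogonal basis \<open>r\<^sub>i\<^sub>j\<close> sum up, with positive weights,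
  to \<open>B\<^sub>0(X, X)\<close>.\<close>

lemma B0_definite:
  assumes "X \<in> spin7" "B0 X X = 0"
  shows "X = 0"
proof -
  have "B0 X X = (\<Sum>(i, j)\<in>pairs7. (B0 X (r i j))\<^sup>2 / 8)"
    by (subst (2) spin7_expansion[OF assms(1)])
       (simp add: B0.sum_right B0.scaleR_right case_prod_unfold power2_eq_square)
  then have "\<forall>(i, j)\<in>pairs7. B0 X (r i j) = 0"
    using assms(2) finite_pairs7 by (auto simp: sum_nonneg_eq_0_iff case_prod_unfold)
  then show ?thesis
    by (subst spin7_expansion[OF assms(1)]) (auto intro!: sum.neutral)
qed

section \<open>The splitting into \<open>h\<close> and \<open>m\<close>, and the Nomizu map\<close>

lemma B0_e_right:
  "B0 X (e 1) = (B0 X (r 1 2) + B0 X (r 3 4) + B0 X (r 5 6)) / (2 * sqrt 6)"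
  "B0 X (e 2) = (B0 X (r 1 3) - B0 X (r 2 4) + B0 X (r 6 7)) / (2 * sqrt 6)"
  "B0 X (e 3) = (B0 X (r 1 4) + B0 X (r 2 3) + B0 X (r 5 7)) / (2 * sqrt 6)"
  "B0 X (e 4) = (- B0 X (r 1 5) + B0 X (r 2 6) + B0 X (r 4 7)) / (2 * sqrt 6)"
  "B0 X (e 5) = - (B0 X (r 1 6) + B0 X (r 2 5) - B0 X (r 3 7)) / (2 * sqrt 6)"
  "B0 X (e 6) = (B0 X (r 1 7) + B0 X (r 3 6) + B0 X (r 4 5)) / (2 * sqrt 6)"
  "B0 X (e 7) = - (B0 X (r 2 7) + B0 X (r 3 5) - B0 X (r 4 6)) / (2 * sqrt 6)"
  by (simp_all add: e_def B0.scaleR_right B0.add_right B0.diff_right B0.minus_right)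

lemma e_in_spin7: "k \<in> {1..7} \<Longrightarrow> e k \<in> spin7"
  unfolding nat_1_7 e_def
  by (elim disjE; simp; intro subspace_scale subspace_add subspace_diff subspace_neg
      subspace_spin7 r_in_spin7; simp)

text \<open>Up to sign and scale, the seven linear equations that define \<open>h\<close> say that the products with
  \<open>e\<^sub>1, \<dots>, e\<^sub>7\<close> vanish. So \<open>h\<close> is an orthogonal complement, and the projection to \<open>m\<close> can be
  written down in terms of the \<open>e\<^sub>k\<close>.\<close>

lemma h_alg_eq: "h_alg = {X \<in> spin7. \<forall>k\<in>{1..7}. B0 X (e k) = 0}"
proof (intro equalityI subsetI)
  fix X assume "X \<in> h_alg"
  then obtain \<omega> where X: "X = (\<Sum>(i, j)\<in>pairs7. \<omega> i j *\<^sub>R r i j)" and w: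
      "\<omega> 1 2 + \<omega> 3 4 + \<omega> 5 6 = 0" "- \<omega> 1 3 + \<omega> 2 4 - \<omega> 6 7 = 0"
      "- \<omega> 1 4 - \<omega> 2 3 - \<omega> 5 7 = 0" "- \<omega> 1 6 - \<omega> 2 5 + \<omega> 3 7 = 0"
      "\<omega> 1 5 - \<omega> 2 6 - \<omega> 4 7 = 0" "\<omega> 1 7 + \<omega> 3 6 + \<omega> 4 5 = 0"
      "\<omega> 2 7 + \<omega> 3 5 - \<omega> 4 6 = 0"
    unfolding h_alg_def by blast
  have b: "B0 X (r i j) = 8 * \<omega> i j" if "(i, j) \<in> pairs7" for i j
    using B0_sum_r[OF that] by (simp add: X)
  have "B0 X (e k) = 0" if "k \<in> {1..7}" for k
    using that w unfolding nat_1_7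
    by (elim disjE; simp add: B0_e_right b pairs7_eq)
  then show "X \<in> {X \<in> spin7. \<forall>k\<in>{1..7}. B0 X (e k) = 0}"
    using sum_r_in_spin7 by (simp add: X)
next
  fix X assume X: "X \<in> {X \<in> spin7. \<forall>k\<in>{1..7}. B0 X (e k) = 0}"
  then have "B0 X (e 1) = 0 \<and> B0 X (e 2) = 0 \<and> B0 X (e 3) = 0 \<and> B0 X (e 4) = 0 \<and> B0 X (e 5) = 0
      \<and> B0 X (e 6) = 0 \<and> B0 X (e 7) = 0" by auto
  note this[unfolded B0_e_right, simplified]
  then show "X \<in> h_alg"
    unfolding h_alg_def using X spin7_expansion[of X]
    by (intro CollectI exI[of _ "\<lambda>i j. B0 X (r i j) / 8"] conjI) (simp_all add: add_divide_distrib)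
qed

lemma B0_e_e:
  assumes "i \<in> {1..7}" "j \<in> {1..7}"
  shows "B0 (e i) (e j) = (if i = j then 1 else 0)"
  using assms unfolding nat_1_7
  by (elim disjE; simp add: e_def B0_linear B0_r)

lemma subspace_h_alg: "subspace h_alg"
  unfolding h_alg_eq using subspace_spin7
  by (auto simp: subspace_def B0.add_left B0.scaleR_left B0.zero_left)

lemma subspace_m_space: "subspace m_space"
  unfolding m_space_def using subspace_spin7
  by (auto simp: subspace_def B0.add_left B0.scaleR_left B0.zero_left)

lemma h_m_orthogonal: "X \<in> h_alg \<Longrightarrow> Y \<in> m_space \<Longrightarrow> B0 X Y = 0"
  by (simp add: m_space_def B0_commute)

lemma m_in_spin7: "X \<in> m_space \<Longrightarrow> X \<in> spin7"
  by (simp add: m_space_def)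

lemma e_in_m_space: "k \<in> {1..7} \<Longrightarrow> e k \<in> m_space"
  using e_in_spin7 B0_commute by (auto simp: m_space_def h_alg_eq)

text \<open>This makes the definite description in \<open>m_part\<close> meaningful: the orthogonal projection to the
  span of the \<open>e\<^sub>k\<close> is a witness, and it is the only one because \<open>h \<inter> m = 0\<close>.\<close>

lemma spin7_decomposition:
  assumes "X \<in> spin7"
  shows "m_part X \<in> m_space" "X - m_part X \<in> h_alg"
proof -
  define Z where "Z = (\<Sum>k\<in>{1..7}. B0 X (e k) *\<^sub>R e k)"
  have Z: "Z \<in> m_space"
    unfolding Z_def using subspace_m_space by (intro subspace_sum subspace_scale e_in_m_space)
  have "B0 Z (e k) = B0 X (e k)" if "k \<in> {1..7}" for k
    using that by (simp add: Z_def B0.sum_left B0.scaleR_left B0_e_e if_distrib cong: if_cong)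
  then have Xh: "X - Z \<in> h_alg"
    using assms m_in_spin7[OF Z] subspace_diff[OF subspace_spin7] by (simp add: h_alg_eq B0.diff_left)
  have "W = Z" if W: "W \<in> m_space" "X - W \<in> h_alg" for W
  proof -
    have "W - Z \<in> m_space" using W(1) Z subspace_diff[OF subspace_m_space] by blast
    moreover have "W - Z \<in> h_alg"
      using subspace_diff[OF subspace_h_alg Xh W(2)] by simp
    ultimately have "W - Z = 0" by (meson B0_definite h_m_orthogonal m_in_spin7)
    then show ?thesis by simp
  qed
  then have "\<exists>!Z. Z \<in> m_space \<and> X - Z \<in> h_alg" using Z Xh by blast
  from theI'[OF this] show "m_part X \<in> m_space" "X - m_part X \<in> h_alg"
    unfolding m_part_def by simp_all
qed

lemma B0_m_part:
  assumes "X \<in> spin7" "Y \<in> m_space"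
  shows "B0 (m_part X) Y = B0 X Y"
  using h_m_orthogonal[OF spin7_decomposition(2)[OF assms(1)] assms(2)] by (simp add: B0.diff_left)

text \<open>The homogeneous space is naturally reductive: by invariance of \<open>B\<^sub>0\<close> the two terms that define
  \<open>U\<close> cancel.\<close>

lemma U_eq_0:
  assumes X: "X \<in> m_space" and Y: "Y \<in> m_space"
  shows "U X Y = 0"
proof -
  have "B0 (m_part (bracket Z X)) Y + B0 X (m_part (bracket Z Y)) = 0" if Z: "Z \<in> m_space" for Z
  proof -
    have "B0 (m_part (bracket Z X)) Y = B0 (bracket Z X) Y"
      using X Y Z by (intro B0_m_part bracket_in_spin7 m_in_spin7)
    moreover have "B0 X (m_part (bracket Z Y)) = B0 X (bracket Z Y)"
      unfolding B0_commute[of X] using X Y Z by (intro B0_m_part bracket_in_spin7 m_in_spin7)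
    moreover have "bracket Z X = - bracket X Z" by (simp add: bracket_def)
    ultimately show ?thesis by (simp add: B0.minus_left B0_bracket)
  qed
  then have "U X Y = (THE W. W \<in> m_space \<and> (\<forall>Z\<in>m_space. B0 W Z = 0))"
    unfolding U_def by (intro arg_cong[of _ _ The] ext) auto
  also have "\<dots> = 0"
    using subspace_0[OF subspace_m_space] B0.zero_left B0_definite m_in_spin7
    by (intro the_equality) auto
  finally show ?thesis .
qed

lemma B0_Lambda_g:
  assumes "X \<in> m_space" "i \<in> {1..7}" "j \<in> {1..7}"
  shows "B0 (Lambda_g X (e i)) (e j) = B0 X (bracket (e i) (e j)) / 2"
  using assms e_in_m_space
  by (simp add: Lambda_g_def U_eq_0 B0.scaleR_left B0_m_part bracket_in_spin7 m_in_spin7 B0_bracket)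

section \<open>The \<open>G\<^sub>2\<close> three-form and the brackets on \<open>m\<close>\<close>

text \<open>The seven oriented lines of a Fano plane on \<open>1, \<dots>, 7\<close>, one per row, each with its three cyclic
  rotations. Every pair of points lies on exactly one line.\<close>

definition fano :: "(nat \<times> nat \<times> nat) set" where
  "fano = {(1,2,3), (2,3,1), (3,1,2),
    (1,4,5), (4,5,1), (5,1,4),
    (1,6,7), (6,7,1), (7,1,6),
    (2,7,4), (7,4,2), (4,2,7),
    (2,6,5), (6,5,2), (5,2,6),
    (3,6,4), (6,4,3), (4,3,6),
    (3,5,7), (5,7,3), (7,3,5)}"

text \<open>The components of the \<open>G\<^sub>2\<close> three-form
  \<open>e\<^sup>1\<^sup>2\<^sup>3 + e\<^sup>1\<^sup>4\<^sup>5 + e\<^sup>1\<^sup>6\<^sup>7 - e\<^sup>2\<^sup>4\<^sup>7 - e\<^sup>2\<^sup>5\<^sup>6 - e\<^sup>3\<^sup>4\<^sup>6 + e\<^sup>3\<^sup>5\<^sup>7\<close>.\<close>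

definition phi :: "nat \<Rightarrow> nat \<Rightarrow> nat \<Rightarrow> real" where
  "phi i j k = (if (i, j, k) \<in> fano then 1 else if (j, i, k) \<in> fano then -1 else 0)"

text \<open>For fixed \<open>k\<close> the sum has three nonzero terms, one for each line through \<open>k\<close>. The single
  brackets have components in \<open>h\<close>, which cancel in the sum; the contraction with \<open>\<phi>\<close> is a
  \<open>G\<^sub>2\<close>-equivariant map, and the part of \<open>spin(7)\<close> isomorphic to \<open>m\<close> as a representation of \<open>h\<close> is
  \<open>m\<close> itself.\<close>

lemma phi_bracket_e:
  assumes "k \<in> {1..7}"
  shows "(\<Sum>(i, j)\<in>pairs7. phi i j k *\<^sub>R bracket (e i) (e j)) = sqrt (3/2) *\<^sub>R e k"
proof -
  \<comment> \<open>Without the factors \<open>1 / (2 \<surd>6)\<close> the identity has integer coefficients.\<close>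
  define f where "f k = (2 * sqrt 6) *\<^sub>R e k" for k
  have f: "f 1 = r 1 2 + r 3 4 + r 5 6" "f 2 = r 1 3 - r 2 4 + r 6 7" "f 3 = r 1 4 + r 2 3 + r 5 7"
    "f 4 = - r 1 5 + r 2 6 + r 4 7" "f 5 = - (r 1 6 + r 2 5 - r 3 7)" "f 6 = r 1 7 + r 3 6 + r 4 5"
    "f 7 = - (r 2 7 + r 3 5 - r 4 6)"
    by (simp_all add: f_def e_def)
  have "(\<Sum>(i, j)\<in>pairs7. phi i j k *\<^sub>R bracket (f i) (f j)) = 6 *\<^sub>R f k"
    using assms unfolding nat_1_7
    by (elim disjE; simp add: pairs7_eq phi_def fano_def)
       (simp_all add: f bracket_linear bracket_r r_descending, simp_all add: vec_eq_iff)
  \<comment> \<open>Here \<open>24 = (2 \<surd>6)\<^sup>2\<close> comes from the two arguments of the bracket, and \<open>12 \<surd>6 = 6 \<cdot> 2 \<surd>6\<close>.\<close>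
  then have "(24::real) *\<^sub>R (\<Sum>(i, j)\<in>pairs7. phi i j k *\<^sub>R bracket (e i) (e j))
      = (12 * sqrt 6) *\<^sub>R e k"
    by (simp add: f_def bracket_linear scaleR_sum_right case_prod_unfold ac_simps)
  also have "12 * sqrt 6 = 24 * sqrt (3/2)"
  proof -
    have "sqrt 6 = sqrt (2^2 * (3/2))" by simp
    then show ?thesis unfolding real_sqrt_mult by simp
  qed
  finally have "(24::real) *\<^sub>R (\<Sum>(i, j)\<in>pairs7. phi i j k *\<^sub>R bracket (e i) (e j)) =
      24 *\<^sub>R (sqrt (3/2) *\<^sub>R e k)" by simp
  then show ?thesis by (simp only: scaleR_cancel_left) simp
qed

lemma phi_B0_bracket:
  assumes "k \<in> {1..7}"
  shows "(\<Sum>(i, j)\<in>pairs7. phi i j k * B0 X (bracket (e i) (e j))) = sqrt (3/2) * B0 X (e k)"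
  using arg_cong[OF phi_bracket_e[OF assms], of "B0 X"]
  by (simp add: B0.sum_right case_prod_unfold B0.scaleR_right)

section \<open>Clifford multiplication in coordinates\<close>

text \<open>Indexing the subsets of \<open>{1, 2, 3}\<close> by three truth values lets the simplifier evaluate
  insertion, removal and counting.\<close>

definition sub3 :: "bool \<Rightarrow> bool \<Rightarrow> bool \<Rightarrow> 3 set" where
  "sub3 p q s = (if p then {1} else {}) \<union> (if q then {2} else {}) \<union> (if s then {3} else {})"

lemma in_sub3: "1 \<in> sub3 p q s \<longleftrightarrow> p" "2 \<in> sub3 p q s \<longleftrightarrow> q" "3 \<in> sub3 p q s \<longleftrightarrow> s"
  by (auto simp: sub3_def)

lemma spinor_eq_iff: "\<eta> = \<zeta> \<longleftrightarrow> (\<forall>p q s. \<eta> $ sub3 p q s = \<zeta> $ sub3 p q s)" for \<eta> \<zeta> :: spinor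
proof -
  have "V = sub3 (1 \<in> V) (2 \<in> V) (3 \<in> V)" for V
    by (simp add: set_eq_iff forall_3 in_sub3)
  then show ?thesis unfolding vec_eq_iff by metis
qed

lemma insert_sub3: "insert 1 (sub3 p q s) = sub3 True q s" "insert 2 (sub3 p q s) = sub3 p True s"
   "insert 3 (sub3 p q s) = sub3 p q True"
  by (auto simp: sub3_def)

lemma remove_sub3: "sub3 p q s - {1} = sub3 False q s" "sub3 p q s - {2} = sub3 p False s"
   "sub3 p q s - {3} = sub3 p q False"
  by (auto simp: sub3_def)

lemma below_sub3: "below 1 (sub3 p q s) = 0" "below 2 (sub3 p q s) = of_bool p"
   "below 3 (sub3 p q s) = of_bool p + of_bool q"
  by (simp_all add: sub3_def below_insert below_empty lbl_def)

lemma even_card_sub3: "even (card (sub3 p q s)) \<longleftrightarrow> (p \<longleftrightarrow> (q \<noteq> s))"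
  by (auto simp: sub3_def)

text \<open>For \<open>k > 1\<close> the basis vectors \<open>e\<^sub>k\<close> with \<open>k div 2 = j\<close> toggle the membership of \<open>j\<close>: wedge
  product and contraction contribute to complementary coefficients. The signs depending on smaller
  elements come from moving \<open>y\<^sub>j\<close> past them.\<close>

lemma cliff_e_nth:
  "cliff_e 1 \<eta> $ sub3 p q s = (if p \<longleftrightarrow> (q \<noteq> s) then \<i> else -\<i>) * \<eta> $ sub3 p q s"
  "cliff_e 2 \<eta> $ sub3 p q s = \<i> * \<eta> $ sub3 (\<not> p) q s"
  "cliff_e 3 \<eta> $ sub3 p q s = (if p then 1 else -1) * \<eta> $ sub3 (\<not> p) q s"
  "cliff_e 4 \<eta> $ sub3 p q s = \<i> * (if p then -1 else 1) * \<eta> $ sub3 p (\<not> q) s"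
  "cliff_e 5 \<eta> $ sub3 p q s = (if p then -1 else 1) * (if q then 1 else -1) * \<eta> $ sub3 p (\<not> q) s"
  "cliff_e 6 \<eta> $ sub3 p q s = \<i> * (if p = q then 1 else -1) * \<eta> $ sub3 p q (\<not> s)"
  "cliff_e 7 \<eta> $ sub3 p q s = (if p = q then 1 else -1) * (if s then 1 else -1) * \<eta> $ sub3 p q (\<not> s)"
  by (auto simp: cliff_e_def contr_def y_wedge_nth in_sub3 insert_sub3 remove_sub3 below_sub3 even_card_sub3
      vector_scalar_mult_def)

lemma cliff_e_scale: "cliff_e k (c *s \<eta>) = c *s cliff_e k \<eta>"
proof -
  have "y j \<and>\<^sub>\<Lambda> (c *s \<eta>) = c *s (y j \<and>\<^sub>\<Lambda> \<eta>)" "contr j (c *s \<eta>) = c *s contr j \<eta>" for j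
    by (simp_all add: vec_eq_iff y_wedge_nth contr_def)
  then show ?thesis
    by (simp add: cliff_e_def Let_def vec_eq_iff algebra_simps)
qed

lemma spin_lift_scale: "spin_lift A (c *s \<eta>) = c *s spin_lift A \<eta>"
  unfolding spin_lift_def vec.scale_sum_right
  by (intro sum.cong refl) (clarsimp simp only: cliff_e_scale vec.scale_scale prod.case mult.commute)

section \<open>The invariant Killing spinor\<close>

definition psi0 :: spinor where "psi0 = - \<one>\<^sub>\<Lambda> + y 1 \<and>\<^sub>\<Lambda> y 2 \<and>\<^sub>\<Lambda> y 3"

lemma psi0_nth: "psi0 $ sub3 p q s = (if p \<and> q \<and> s then 1 else if \<not> p \<and> \<not> q \<and> \<not> s then -1 else 0)"
proof -
  have *: "sub3 p q s = {} \<longleftrightarrow> \<not> p \<and> \<not> q \<and> \<not> s" "sub3 p q s = {3} \<longleftrightarrow> \<not> p \<and> \<not> q \<and> s" for p q s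
    by (auto simp: sub3_def)
  show ?thesis
    by (cases p; cases q; cases s)
      (simp_all add: psi0_def one_form_def y_wedge_nth in_sub3 remove_sub3 below_sub3
        y_def[of 3] axis_def *)
qed

text \<open>The \<open>e\<^sub>k \<cdot> \<psi>\<close> and \<open>\<psi>\<close> are a basis of the spin module, and the real number \<open>\<phi>\<^sub>i\<^sub>j\<^sub>k\<close> is the
  coefficient of \<open>e\<^sub>k \<cdot> \<psi>\<close> in \<open>e\<^sub>i \<cdot> e\<^sub>j \<cdot> \<psi>\<close>; this is how a spinor determines a \<open>G\<^sub>2\<close>-structure.
  With the orientations chosen in \<open>fano\<close> it is checked coefficient by coefficient.\<close>

lemma cliff_e_cliff_e_psi0:
  assumes "(i, j) \<in> pairs7"
  shows "cliff_e i (cliff_e j psi0) = (\<Sum>k\<in>{1..7}. complex_of_real (phi i j k) *s cliff_e k psi0)"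
proof -
  have "\<forall>(i, j)\<in>pairs7.
      cliff_e i (cliff_e j psi0) = (\<Sum>k\<in>{1..7}. complex_of_real (phi i j k) *s cliff_e k psi0)"
    unfolding pairs7_eq atLeastAtMost_1_7
    by (simp add: phi_def fano_def,
        simp add: spinor_eq_iff all_bool_eq, simp add: cliff_e_nth psi0_nth)
  then show ?thesis using assms by blast
qed

lemma spin_lift_psi0:
  "spin_lift A psi0 = (\<Sum>k\<in>{1..7}.
     complex_of_real ((\<Sum>(i, j)\<in>pairs7. phi i j k * B0 (A (e i)) (e j)) / 2) *s cliff_e k psi0)"
proof -
  have "spin_lift A psi0 = (\<Sum>(i, j)\<in>pairs7. \<Sum>k\<in>{1..7}.
      complex_of_real (phi i j k * B0 (A (e i)) (e j) / 2) *s cliff_e k psi0)"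
    unfolding spin_lift_def
  proof (intro sum.cong refl, clarify)
    fix i j assume ij: "(i, j) \<in> pairs7"
    have *: "complex_of_real (B0 (A (e i)) (e j)) * (1/2) * complex_of_real (phi i j k)
        = complex_of_real (phi i j k * B0 (A (e i)) (e j) / 2)" for k
      by simp
    show "(complex_of_real (B0 (A (e i)) (e j)) * (1/2)) *s cliff_e i (cliff_e j psi0) =
        (\<Sum>k\<in>{1..7}. complex_of_real (phi i j k * B0 (A (e i)) (e j) / 2) *s cliff_e k psi0)"
      unfolding cliff_e_cliff_e_psi0[OF ij] vec.scale_sum_right vec.scale_scale * ..
  qed
  also have "\<dots> = (\<Sum>k\<in>{1..7}. \<Sum>(i, j)\<in>pairs7.
      complex_of_real (phi i j k * B0 (A (e i)) (e j) / 2) *s cliff_e k psi0)"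
    unfolding case_prod_unfold by (rule sum.swap)
  finally show ?thesis
    by (simp add: vec.scale_sum_left case_prod_unfold sum_divide_distrib)
qed

lemma psi0_invariant:
  assumes "h \<in> h_alg"
  shows "spin_lift (bracket h) psi0 = 0"
proof -
  have "(\<Sum>(i, j)\<in>pairs7. phi i j k * B0 (bracket h (e i)) (e j)) = 0" if "k \<in> {1..7}" for k
    using phi_B0_bracket[OF that, of h] h_m_orthogonal[OF assms e_in_m_space[OF that]]
    by (simp add: B0_bracket)
  then show ?thesis unfolding spin_lift_psi0 by (intro sum.neutral) auto
qed

text \<open>The Killing constant is the product of \<open>1/2\<close> from the spin lift, \<open>1/2\<close> from the Nomizu map
  and \<open>\<surd>(3/2)\<close> from the contraction of \<open>\<phi>\<close> with the brackets.\<close>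

lemma psi0_killing:
  assumes "X \<in> m_space"
  shows "nabla X psi0 = complex_of_real (sqrt 3 / (4 * sqrt 2)) *s cliff X psi0"
proof -
  have "(\<Sum>(i, j)\<in>pairs7. phi i j k * B0 (Lambda_g X (e i)) (e j)) = sqrt (3/2) * B0 X (e k) / 2"
    if "k \<in> {1..7}" for k
  proof -
    have "(\<Sum>(i, j)\<in>pairs7. phi i j k * B0 (Lambda_g X (e i)) (e j))
        = (\<Sum>(i, j)\<in>pairs7. phi i j k * B0 X (bracket (e i) (e j))) / 2"
      unfolding sum_divide_distrib
      using pairs7_range by (intro sum.cong refl) (auto simp: B0_Lambda_g[OF assms])
    then show ?thesis using phi_B0_bracket[OF that] by simp
  qed
  then show ?thesis
    unfolding nabla_def spin_lift_psi0 cliff_def vec.scale_sum_right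
    by (intro sum.cong refl) (simp add: real_sqrt_divide)
qed

section \<open>Uniqueness of the invariant spinor\<close>

text \<open>The endomorphism \<open>2 (e\<^sub>a \<and> e\<^sub>b) - 2 (e\<^sub>c \<and> e\<^sub>d)\<close> on the basis of \<open>m\<close>. It preserves \<open>\<phi>\<close>, as the
  elements of \<open>h\<close> do, if \<open>\<phi>\<^sub>a\<^sub>b\<^sub>k = \<phi>\<^sub>c\<^sub>d\<^sub>k \<noteq> 0\<close> for some \<open>k\<close>. The planes used below come from
  \<open>k = 1\<close> and \<open>k = 2\<close>.\<close>

definition rotates_planes :: "nat \<Rightarrow> nat \<Rightarrow> nat \<Rightarrow> nat \<Rightarrow> (mat8 \<Rightarrow> mat8) \<Rightarrow> bool" where
  "rotates_planes a b c d A \<longleftrightarrow> (\<forall>i\<in>{1..7}. A (e i) =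
    (if i = a then 2 *\<^sub>R e b else if i = b then -2 *\<^sub>R e a
     else if i = c then -2 *\<^sub>R e d else if i = d then 2 *\<^sub>R e c else 0))"

text \<open>The first two elements span a Cartan subalgebra of \<open>h\<close>; the third one does not commute with
  it.\<close>

lemma h_rotations:
  "rotates_planes 4 5 6 7 (bracket (r 1 2 - r 3 4))"
  "rotates_planes 2 3 4 5 (bracket (r 3 4 - r 5 6))"
  "rotates_planes 1 3 5 6 (bracket (r 2 4 + r 6 7))"
proof -
  \<comment> \<open>Hiding the value \<open>1 / (2 \<surd>6)\<close> of the common factor keeps square roots out of the brackets.\<close>
  obtain c where e: "e 1 = c *\<^sub>R (r 1 2 + r 3 4 + r 5 6)" "e 2 = c *\<^sub>R (r 1 3 - r 2 4 + r 6 7)"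
    "e 3 = c *\<^sub>R (r 1 4 + r 2 3 + r 5 7)" "e 4 = c *\<^sub>R (- r 1 5 + r 2 6 + r 4 7)"
    "e 5 = c *\<^sub>R - (r 1 6 + r 2 5 - r 3 7)" "e 6 = c *\<^sub>R (r 1 7 + r 3 6 + r 4 5)"
    "e 7 = c *\<^sub>R - (r 2 7 + r 3 5 - r 4 6)"
    by (rule that[of "1 / (2 * sqrt 6)"]) (simp_all add: e_def)
  show "rotates_planes 4 5 6 7 (bracket (r 1 2 - r 3 4))"
    "rotates_planes 2 3 4 5 (bracket (r 3 4 - r 5 6))"
    "rotates_planes 1 3 5 6 (bracket (r 2 4 + r 6 7))"
    unfolding rotates_planes_def atLeastAtMost_1_7
    by (simp_all add: e, simp_all add: bracket_linear bracket_r r_descending r_same,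
        simp_all add: vec_eq_iff, simp_all add: algebra_simps)
qed

lemma h_alg_elements: "r 1 2 - r 3 4 \<in> h_alg" "r 3 4 - r 5 6 \<in> h_alg" "r 2 4 + r 6 7 \<in> h_alg"
  unfolding h_alg_eq atLeastAtMost_1_7
  by (simp_all add: subspace_spin7 r_in_spin7 subspace_add subspace_diff
    B0_e_right B0.diff_left B0.add_left B0_r)

lemma spin_lift_rotates_planes:
  assumes A: "rotates_planes a b c d A" and "a < b" "c < d" "distinct [a, b, c, d]"
    and range: "{a, b, c, d} \<subseteq> {1..7}"
  shows "spin_lift A \<eta> = cliff_e a (cliff_e b \<eta>) - cliff_e c (cliff_e d \<eta>)"
proof -
  have ab: "(a, b) \<in> pairs7" "(c, d) \<in> pairs7"
    using assms by (auto simp: pairs7_def)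
  have "B0 (A (e i)) (e j) = (if (i, j) = (a, b) then 2 else 0) - (if (i, j) = (c, d) then 2 else 0)"
    if ij: "(i, j) \<in> pairs7" for i j
  proof -
    have ij: "i \<in> {1..7}" "j \<in> {1..7}" "i < j" using pairs7_range[OF ij] by auto
    have "A (e i) = (if i = a then 2 *\<^sub>R e b else if i = b then -2 *\<^sub>R e a
       else if i = c then -2 *\<^sub>R e d else if i = d then 2 *\<^sub>R e c else 0)"
      using A ij unfolding rotates_planes_def by blast
    then show ?thesis using ij assms
      by (auto simp: B0.scaleR_left B0.minus_left B0.zero_left B0_e_e)
  qed
  then have "spin_lift A \<eta> = (\<Sum>p\<in>pairs7. (if p = (a, b) then cliff_e a (cliff_e b \<eta>) else 0)
      - (if p = (c, d) then cliff_e c (cliff_e d \<eta>) else 0))"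
    unfolding spin_lift_def using assms(4) by (intro sum.cong refl) (auto split: if_splits)
  then show ?thesis
    using ab finite_pairs7 by (simp add: sum_subtractf)
qed

lemma Sigma_inv_equations:
  assumes "\<eta> \<in> Sigma_inv"
  shows "cliff_e 4 (cliff_e 5 \<eta>) = cliff_e 6 (cliff_e 7 \<eta>)"
    "cliff_e 2 (cliff_e 3 \<eta>) = cliff_e 4 (cliff_e 5 \<eta>)"
    "cliff_e 1 (cliff_e 3 \<eta>) = cliff_e 5 (cliff_e 6 \<eta>)"
proof -
  have 0: "spin_lift (bracket h) \<eta> = 0" if "h \<in> h_alg" for h
    using assms that by (simp add: Sigma_inv_def)
  show "cliff_e 4 (cliff_e 5 \<eta>) = cliff_e 6 (cliff_e 7 \<eta>)"
    "cliff_e 2 (cliff_e 3 \<eta>) = cliff_e 4 (cliff_e 5 \<eta>)"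
    "cliff_e 1 (cliff_e 3 \<eta>) = cliff_e 5 (cliff_e 6 \<eta>)"
    using 0[OF h_alg_elements(1)] 0[OF h_alg_elements(2)] 0[OF h_alg_elements(3)]
      spin_lift_rotates_planes[OF h_rotations(1), of \<eta>]
      spin_lift_rotates_planes[OF h_rotations(2), of \<eta>]
      spin_lift_rotates_planes[OF h_rotations(3), of \<eta>]
    by simp_all
qed

text \<open>On the wedge product of the \<open>y\<^sub>j\<close>, \<open>j \<in> S\<close>, the operator \<open>e\<^sub>2\<^sub>j \<cdot> e\<^sub>2\<^sub>j\<^sub>+\<^sub>1\<close> is multiplication by
  \<open>- \<i>\<close> if \<open>j \<in> S\<close> and by \<open>\<i>\<close> otherwise. If the operators for \<open>j = 1, 2, 3\<close> agree on \<open>\<eta>\<close>, only the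
  coefficients at \<open>S = {}\<close> and \<open>S = {1, 2, 3}\<close> can be nonzero.\<close>

lemma Sigma_inv_multiple:
  assumes "\<eta> \<in> Sigma_inv"
  shows "\<eta> = \<eta> $ UNIV *s psi0"
proof -
  have U: "UNIV = sub3 True True True" by (simp add: set_eq_iff forall_3 in_sub3)
  note eqs = Sigma_inv_equations[OF assms]
  have "\<eta> $ sub3 p q s = 0" if "\<not> (p = q \<and> q = s)" for p q s
    using that arg_cong[OF eqs(1), of "\<lambda>\<zeta>. \<zeta> $ sub3 p q s"]
      arg_cong[OF eqs(2), of "\<lambda>\<zeta>. \<zeta> $ sub3 p q s"]
    by (cases p; cases q; cases s; simp add: cliff_e_nth)
  \<comment> \<open>At \<open>S = {2, 3}\<close> the left-hand side of the third equation involves the coefficient of \<open>\<eta>\<close> at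
    \<open>{1, 2, 3}\<close>, and the right-hand side the one at \<open>{}\<close>.\<close>
  moreover have "\<i> * \<eta> $ sub3 False False False = \<i> * - \<eta> $ sub3 True True True"
    using arg_cong[OF eqs(3), of "\<lambda>\<zeta>. \<zeta> $ sub3 False True True"]
    by (simp add: cliff_e_nth)
  then have "\<eta> $ sub3 False False False = - \<eta> $ sub3 True True True"
    by (simp only: mult_cancel_left) simp
  ultimately show ?thesis
    unfolding spinor_eq_iff by (simp add: psi0_nth U all_bool_eq)
qed

lemma Sigma_inv_eq: "Sigma_inv = vec.span {psi0}"
proof -
  have "c *s psi0 \<in> Sigma_inv" for c
    by (simp add: Sigma_inv_def spin_lift_scale psi0_invariant)
  then show ?thesis
    unfolding vec.span_singleton using Sigma_inv_multiple by blast
qed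

theorem theorem5p5:
  fixes \<psi> :: spinor
  assumes psi: "\<psi> = - \<one>\<^sub>\<Lambda> + y 1 \<and>\<^sub>\<Lambda> y 2 \<and>\<^sub>\<Lambda> y 3"
  shows "Sigma_inv = vec.span {\<psi>} \<and>
    (\<forall>X\<in>m_space. nabla X \<psi> = complex_of_real (sqrt 3 / (4 * sqrt 2)) *s cliff X \<psi>)"
proof -
  have "\<psi> = psi0" by (simp add: psi psi0_def)
  then show ?thesis using Sigma_inv_eq psi0_killing by simp
qed

end
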